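(* Let $p$ be a prime number. If $n$ is not divisible by $p$, then there exists a nonlinear $n$-variable balanced symmetric polynomial over $GF(p)$.
   Context: Here $n$ is the number of variables (a positive integer). Every function $f:GF(p)^n\to GF(p)$ is identified with its unique polynomial representation (algebraic normal form) $f(x_1,\ldots,x_n)=\sum_{k_1,\ldots,k_n=0}^{p-1}a_{k_1\ldots k_n}x_1^{k_1}\cdots x_n^{k_n}$ with coefficients $a_{k_1\ldots k_n}\in GF(p)$. $f$ is symmetric if $f(x_{\pi(1)},\ldots,x_{\pi(n)})=f(x_1,\ldots,x_n)$ for every permutation $\pi$ of $\{1,\ldots,n\}$. $f$ is balanced if $\#\{x\in GF(p)^n: f(x)=k\}=p^{n-1}$ for every $k\in GF(p)$. $f$ is affine if $f(x)=a_1x_1+\cdots+a_nx_n+a_0$ with all $a_i\in GF(p)$; $f$ is called nonlinear if it is not affine.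
   Formalization: The cases n = 1 with p = 2 or p = 3 are excluded, because there every balanced polynomial is a permutation of GF(p) and hence affine, so the claim fails in exactly these cases. *)

theory Defs
  imports "HOL-Analysis.Finite_Cartesian_Product" "HOL-Computational_Algebra.Primes"
begin

text \<open>
  The field GF(p) is any type of class \<open>{field, finite}\<close> whose cardinality is the prime \<open>p\<close>,
  and GF(p)^n is \<open>'a ^ 'n\<close> with \<open>CARD('n) = n\<close>, so that \<open>n\<close> is positive.
  A polynomial in algebraic normal form is given by its coefficient family, indexed by
  exponent vectors; coefficients at exponents outside \<open>{0..p-1}\<close> are ignored.
\<close>

definition anf_eval :: "(('n::finite \<Rightarrow> nat) \<Rightarrow> 'a) \<Rightarrow> ('a::{field,finite}) ^ 'n \<Rightarrow> 'a" where
  "anf_eval a x = (\<Sum>k | \<forall>i. k i < CARD('a). a k * (\<Prod>i\<in>UNIV. (x $ i) ^ k i))"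

definition symmetric_fun :: "('a ^ 'n::finite \<Rightarrow> 'a) \<Rightarrow> bool" where
  "symmetric_fun f \<longleftrightarrow> (\<forall>\<pi> x. bij \<pi> \<longrightarrow> f (\<chi> i. x $ \<pi> i) = f x)"

definition balanced_fun :: "('a::finite ^ 'n::finite \<Rightarrow> 'a) \<Rightarrow> bool" where
  "balanced_fun f \<longleftrightarrow> (\<forall>c. card {x. f x = c} = CARD('a) ^ (CARD('n) - 1))"

definition affine_fun :: "('a::field ^ 'n::finite \<Rightarrow> 'a) \<Rightarrow> bool" where
  "affine_fun f \<longleftrightarrow> (\<exists>b b0. \<forall>x. f x = (\<Sum>i\<in>UNIV. b i * x $ i) + b0)"

text \<open>
  In one variable over GF(2) or GF(3) every balanced function is a permutation of the field and
  hence affine, so a nonlinear balanced function requires \<open>n \<noteq> 1\<close> or \<open>p > 3\<close>.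
\<close>

definition nonlinear_fun :: "('a::field ^ 'n::finite \<Rightarrow> 'a) \<Rightarrow> bool" where
  "nonlinear_fun f \<longleftrightarrow> \<not> affine_fun f"

end

theory Submission
  imports Defs "HOL-Computational_Algebra.Polynomial"
begin

text \<open>
  If a symmetric function \<open>g\<close> is invariant under translation along the diagonal, then adding it to
  the coordinate sum \<open>s\<close> gives a function that translation by \<open>(c, \<dots>, c)\<close> increases by \<open>n c\<close>.
  As \<open>n\<close> is invertible in GF(p), translations carry any fibre onto any other, so \<open>s + g\<close> is
  balanced. For \<open>n \<ge> 2\<close> the indicator of the diagonal is such a \<open>g\<close>, and it is not affine. For
  \<open>n = 1\<close> and \<open>p > 3\<close> the transposition of 0 and 1 is a nonlinear permutation of GF(p).
\<close>

text \<open>Lagrange interpolation: the product of \<open>X - z\<close> over all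
  \<open>z \<noteq> y\<close> vanishes everywhere except at \<open>y\<close> and has degree below
  \<open>CARD('a)\<close>. Dividing it by its value at \<open>y\<close> gives the indicator.\<close>

lemma indicator_eq_power_sum:
  fixes y :: "'a::{field,finite}"
  obtains c where "\<And>x. (if x = y then 1 else 0) = (\<Sum>k<CARD('a). c k * x ^ k)"
proof -
  define q where "q = (\<Prod>z\<in>UNIV - {y}. [:- z, 1:])"
  have "degree q \<le> sum (degree \<circ> (\<lambda>z. [:- z, 1:])) (UNIV - {y})"
    unfolding q_def by (rule degree_prod_sum_le) simp
  also have "\<dots> < CARD('a)"
    by (simp add: card_Diff_singleton zero_less_card_finite)
  finally have deg: "degree q < CARD('a)" .
  have q_eq: "poly q x = (\<Sum>k<CARD('a). coeff q k * x ^ k)" for x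
    unfolding poly_altdef by (rule sum.mono_neutral_left) (use deg in \<open>auto simp: coeff_eq_0\<close>)
  have "poly q y \<noteq> 0"
    by (auto simp: q_def poly_prod)
  moreover have "poly q x = 0" if "x \<noteq> y" for x
    using that by (auto simp: q_def poly_prod)
  ultimately have "(if x = y then 1 else 0) = (\<Sum>k<CARD('a). (coeff q k / poly q y) * x ^ k)" for x
    using q_eq[of x] by (auto simp flip: sum_divide_distrib)
  then show ?thesis
    by (rule that)
qed

text \<open>Write \<open>f\<close> as the combination of point indicators with weights
  \<open>f y\<close>; each of these is a product of one-variable indicators, and multiplying out
  yields the coefficients. Thus the construction may work with arbitrary functions.\<close>

lemma anf_eval_surj:
  fixes f :: "('a::{field,finite}) ^ 'n::finite \<Rightarrow> 'a"
  obtains a where "anf_eval a = f"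
proof -
  obtain c :: "'a \<Rightarrow> nat \<Rightarrow> 'a"
    where c: "\<And>y x. (if x = y then 1 else 0) = (\<Sum>k<CARD('a). c y k * x ^ k)"
    using indicator_eq_power_sum by metis
  define a where "a k = (\<Sum>y\<in>UNIV. f y * (\<Prod>i\<in>UNIV. c (y $ i) (k i)))" for k
  have exps: "{k :: 'n \<Rightarrow> nat. \<forall>i. k i < CARD('a)} = PiE UNIV (\<lambda>_. {..<CARD('a)})"
    by (auto simp: PiE_def Pi_def)
  have "anf_eval a x = f x" for x
  proof -
    have "anf_eval a x = (\<Sum>y\<in>UNIV. f y *
        (\<Sum>k | \<forall>i. k i < CARD('a). \<Prod>i\<in>UNIV. c (y $ i) (k i) * x $ i ^ k i))"
      unfolding anf_eval_def a_def sum_distrib_right sum_distrib_left prod.distrib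
      by (subst sum.swap) (simp add: mult.assoc)
    \<comment> \<open>Distributivity: a sum over all exponent vectors of coordinatewise products is
      a product of one-variable sums.\<close>
    also have "\<dots> = (\<Sum>y\<in>UNIV. f y * (\<Prod>i\<in>UNIV. if x $ i = y $ i then 1 else 0))"
      unfolding exps c by (subst prod_sum_PiE) auto
    also have "\<dots> = (\<Sum>y\<in>UNIV. if y = x then f y else 0)"
    proof (rule sum.cong)
      fix y
      show "f y * (\<Prod>i\<in>UNIV. if x $ i = y $ i then 1 else 0) = (if y = x then f y else 0)"
        by (auto simp: vec_eq_iff)
    qed simp
    finally show ?thesis by simp
  qed
  then show ?thesis
    using that by blast
qed

text \<open>Exchanging \<open>c\<close> and \<open>d\<close> makes all fibres equally large, and
  they partition a space of \<open>CARD('a) ^ CARD('n)\<close> points into \<open>CARD('a)\<close>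
  classes.\<close>

lemma balanced_funI_card_eq:
  fixes f :: "'a::finite ^ 'n::finite \<Rightarrow> 'a"
  assumes "\<And>c d. card {x. f x = c} \<le> card {x. f x = d}"
  shows "balanced_fun f"
  unfolding balanced_fun_def
proof
  fix c
  have "CARD('a) ^ CARD('n) = card (\<Union>d\<in>UNIV. {x. f x = d})"
    by (simp flip: CARD_vec add: UNION_singleton_eq_range)
      (rule arg_cong[where f = card], auto)
  also have "\<dots> = (\<Sum>d\<in>UNIV. card {x. f x = d})"
    by (rule card_UN_disjoint) auto
  also have "\<dots> = (\<Sum>d\<in>(UNIV :: 'a set). card {x. f x = c})"
    by (rule sum.cong) (auto intro: antisym assms)
  finally have "CARD('a) ^ CARD('n) = CARD('a) * card {x. f x = c}"
    by simp
  moreover have "CARD('a) ^ CARD('n) = CARD('a) * CARD('a) ^ (CARD('n) - 1)"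
    by (metis power_minus_mult zero_less_card_finite mult.commute)
  ultimately show "card {x. f x = c} = CARD('a) ^ (CARD('n) - 1)"
    by simp
qed

lemma balanced_fun_translation:
  fixes f :: "('a::{field,finite}) ^ 'n::finite \<Rightarrow> 'a"
  assumes shift: "\<And>x t. f (x + vec t) = f x + of_nat CARD('n) * t"
    and nz: "of_nat CARD('n) \<noteq> (0 :: 'a)"
  shows "balanced_fun f"
proof (rule balanced_funI_card_eq)
  fix c d :: 'a
  show "card {x. f x = c} \<le> card {x. f x = d}"
    \<comment> \<open>This diagonal shift raises \<open>f\<close> by exactly
      \<open>d - c\<close>.\<close>
    by (rule card_inj_on_le[where f = "\<lambda>x. x + vec ((d - c) / of_nat CARD('n))"])
      (auto simp: inj_on_def shift nz)
qed

lemma balanced_fun_comp_bij: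
  assumes "balanced_fun f" and "bij \<sigma>"
  shows "balanced_fun (\<lambda>x. \<sigma> (f x))"
proof -
  have "{x. \<sigma> (f x) = c} = {x. f x = inv \<sigma> c}" for c
    using assms(2) by (auto simp: bij_is_inj bij_is_surj surj_f_inv_f)
  then show ?thesis
    using assms(1) by (simp add: balanced_fun_def)
qed

text \<open>A necessary condition for affinity that can be refuted at a single pair of
  points.\<close>

lemma affine_fun_add:
  assumes "affine_fun f"
  shows "f (x + y) + f 0 = f x + f y"
  using assms by (auto simp: affine_fun_def algebra_simps sum.distrib)

lemma sum_coords_add_vec:
  fixes x :: "('a::comm_semiring_1) ^ 'n::finite"
  shows "(\<Sum>i\<in>UNIV. (x + vec t) $ i) = (\<Sum>i\<in>UNIV. x $ i) + of_nat CARD('n) * t"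
  by (simp add: sum.distrib)

lemma sum_coords_permute:
  fixes x :: "('a::comm_monoid_add) ^ 'n::finite"
  assumes "bij \<pi>"
  shows "(\<Sum>i\<in>UNIV. x $ \<pi> i) = (\<Sum>i\<in>UNIV. x $ i)"
  using sum.reindex_bij_betw[OF assms, of "\<lambda>i. x $ i"] .

lemma sum_axis: "(\<Sum>i\<in>UNIV. axis j c $ i) = c"
  by (simp add: axis_def)

text \<open>Since \<open>x \<mapsto> x + 1\<close> permutes the field, summing over it gives
  \<open>CARD('a) = 0\<close> in the field. So the characteristic divides a prime, and it is not
  1.\<close>

lemma of_nat_eq_0_iff_prime_card:
  assumes "prime CARD('a::{field,finite})"
  shows "of_nat m = (0 :: 'a) \<longleftrightarrow> CARD('a) dvd m"
proof -
  have "(\<Sum>x\<in>(UNIV :: 'a set). x + 1) = (\<Sum>x\<in>UNIV. x)"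
    by (rule sum.reindex_bij_betw) (rule bij_plus_right)
  then have "CHAR('a) dvd CARD('a)"
    by (simp add: sum.distrib flip: of_nat_eq_0_iff_char_dvd)
  then have "CHAR('a) = CARD('a)"
    using assms CHAR_not_1[where 'a = 'a] by (auto simp: prime_nat_iff)
  then show ?thesis
    by (simp add: of_nat_eq_0_iff_char_dvd)
qed

lemma exists_nonlinear_balanced_symmetric_several:
  assumes prime: "prime CARD('a::{field,finite})"
    and ndvd: "\<not> CARD('a) dvd CARD('n::finite)" and n: "CARD('n) \<noteq> 1"
  shows "\<exists>f :: 'a ^ 'n \<Rightarrow> 'a. nonlinear_fun f \<and> balanced_fun f \<and> symmetric_fun f"
proof (intro exI conjI)
  define f :: "'a ^ 'n \<Rightarrow> 'a" where
    "f x = (\<Sum>i\<in>UNIV. x $ i) + (if \<forall>i j. x $ i = x $ j then 1 else 0)" for x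
  show "symmetric_fun f"
    unfolding symmetric_fun_def
  proof (intro allI impI)
    fix \<pi> :: "'n \<Rightarrow> 'n" and x :: "'a ^ 'n"
    assume \<pi>: "bij \<pi>"
    have "(\<forall>i j. x $ \<pi> i = x $ \<pi> j) \<longleftrightarrow> (\<forall>i j. x $ i = x $ j)"
      by (metis \<pi> bij_pointE)
    then show "f (\<chi> i. x $ \<pi> i) = f x"
      by (simp add: f_def sum_coords_permute[OF \<pi>])
  qed
  show "balanced_fun f"
  proof (rule balanced_fun_translation)
    show "f (x + vec t) = f x + of_nat CARD('n) * t" for x t
      unfolding f_def sum_coords_add_vec by simp
    show "of_nat CARD('n) \<noteq> (0 :: 'a)"
      using ndvd by (simp add: of_nat_eq_0_iff_prime_card[OF prime])
  qed
  show "nonlinear_fun f"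
    unfolding nonlinear_fun_def
  proof
    assume aff: "affine_fun f"
    obtain i j :: 'n where ij: "i \<noteq> j"
      using n by (metis (full_types) UNIV_I card_1_singleton_iff is_singletonI' is_singleton_def
          UNIV_not_empty One_nat_def)
    have diag: "\<not> (\<forall>k l. axis m c $ k = axis m c $ l)" if "c \<noteq> 0" for m :: 'n and c :: 'a
    proof -
      obtain l where "l \<noteq> m"
        using ij by metis
      then show ?thesis
        using that by (auto simp: axis_def intro!: exI[of _ m] exI[of _ l])
    qed
    \<comment> \<open>On the diagonal, entries \<open>i\<close> and \<open>j\<close> give
      \<open>1 = - 1\<close>, so \<open>p = 2\<close>. A third entry would be 0, so
      \<open>n = 2\<close>, which \<open>p\<close> divides.\<close>
    have diag2: "\<not> (\<forall>k l. (axis i 1 + axis j (- 1) :: 'a ^ 'n) $ k = (axis i 1 + axis j (- 1)) $ l)"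
    proof
      assume eq: "\<forall>k l. (axis i 1 + axis j (- 1) :: 'a ^ 'n) $ k = (axis i 1 + axis j (- 1)) $ l"
      then have "(1 :: 'a) = - 1"
        using ij spec[OF spec[OF eq, of i], of j] by (simp add: axis_def)
      then have "of_nat 2 = (0 :: 'a)"
        by (simp add: eq_neg_iff_add_eq_0)
      then have "CARD('a) dvd 2"
        using of_nat_eq_0_iff_prime_card[OF prime] by blast
      then have "CARD('a) = 2"
        using prime by (simp add: primes_dvd_imp_eq)
      have "k = i \<or> k = j" for k
        using spec[OF spec[OF eq, of k], of i] ij by (auto simp: axis_def split: if_splits)
      then have "(UNIV :: 'n set) = {i, j}"
        by auto
      then have "CARD('n) = 2"
        using ij by (metis card_2_iff)
      then show False
        using ndvd \<open>CARD('a) = 2\<close> by simp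
    qed
    \<comment> \<open>Only 0 among the four points lies on the diagonal, so additivity would read
      \<open>0 + 1 = 1 + (- 1)\<close>.\<close>
    have "f (axis i 1 + axis j (- 1)) = 0"
      unfolding f_def if_not_P[OF diag2] by (simp add: sum.distrib sum_axis)
    moreover have "f (axis m c) = c" if "c \<noteq> 0" for m c
      unfolding f_def if_not_P[OF diag[OF that]] by (simp add: sum_axis)
    moreover have "f 0 = 1"
      by (simp add: f_def)
    ultimately show False
      using affine_fun_add[OF aff, of "axis i 1" "axis j (- 1)"] by simp
  qed
qed

text \<open>The coordinate sum is balanced and symmetric, and following it by a permutation of the
  field preserves both properties.\<close>

lemma exists_nonlinear_balanced_symmetric_large:
  assumes prime: "prime CARD('a::{field,finite})"
    and ndvd: "\<not> CARD('a) dvd CARD('n::finite)" and p: "CARD('a) > 3"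
  shows "\<exists>f :: 'a ^ 'n \<Rightarrow> 'a. nonlinear_fun f \<and> balanced_fun f \<and> symmetric_fun f"
proof (intro exI conjI)
  define \<sigma> :: "'a \<Rightarrow> 'a" where "\<sigma> t = (if t = 0 then 1 else if t = 1 then 0 else t)" for t
  define f :: "'a ^ 'n \<Rightarrow> 'a" where "f x = \<sigma> (\<Sum>i\<in>UNIV. x $ i)" for x
  show "symmetric_fun f"
    by (simp add: symmetric_fun_def f_def sum_coords_permute)
  have "balanced_fun (\<lambda>x :: 'a ^ 'n. \<Sum>i\<in>UNIV. x $ i)"
    using ndvd
    by (intro balanced_fun_translation sum_coords_add_vec)
      (simp add: of_nat_eq_0_iff_prime_card[OF prime])
  moreover have "bij \<sigma>"
    by (rule o_bij[where g = \<sigma>]) (auto simp: \<sigma>_def fun_eq_iff)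
  ultimately show "balanced_fun f"
    unfolding f_def by (rule balanced_fun_comp_bij)
  show "nonlinear_fun f"
    unfolding nonlinear_fun_def
  proof
    assume aff: "affine_fun f"
    \<comment> \<open>As 2 is neither 0 nor 1, \<open>\<sigma>\<close> fixes it; additivity at
      \<open>axis i 1\<close> taken twice would then read \<open>2 + 1 = 0 + 0\<close>.\<close>
    have "of_nat 2 \<noteq> (0 :: 'a)" "of_nat 3 \<noteq> (0 :: 'a)"
      using p by (auto simp only: of_nat_eq_0_iff_prime_card[OF prime] dest: dvd_imp_le)
    then have two: "(2 :: 'a) \<noteq> 0" and three: "(3 :: 'a) \<noteq> 0"
      by simp_all
    have "(2 :: 'a) \<noteq> 1"
      by (metis add_cancel_left_right one_add_one zero_neq_one)
    fix i :: 'n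
    have "f (axis i 1 + axis i 1) = 2"
      unfolding f_def vector_add_component sum.distrib sum_axis one_add_one
      using two \<open>2 \<noteq> 1\<close> by (simp add: \<sigma>_def)
    moreover have "f (axis i 1) = 0" "f 0 = 1"
      by (simp_all add: f_def \<sigma>_def sum_axis)
    ultimately have "(3 :: 'a) = 0"
      using affine_fun_add[OF aff, of "axis i 1" "axis i 1"] by simp
    with three show False ..
  qed
qed

theorem corollary2:
  fixes p n :: nat
  assumes "prime p" and "CARD('a::{field,finite}) = p" and "CARD('n::finite) = n"
    and "\<not> p dvd n"
    and "\<not> (n = 1 \<and> p \<le> 3)"
  shows "\<exists>a :: ('n \<Rightarrow> nat) \<Rightarrow> 'a.
    nonlinear_fun (anf_eval a) \<and> balanced_fun (anf_eval a) \<and> symmetric_fun (anf_eval a)"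
proof -
  have "\<exists>f :: 'a ^ 'n \<Rightarrow> 'a. nonlinear_fun f \<and> balanced_fun f \<and> symmetric_fun f"
  \<comment> \<open>For \<open>n = 1\<close> the diagonal is the whole space and its indicator is
    constant, so the first construction would stay affine.\<close>
  proof (cases "n = 1")
    case True
    then show ?thesis
      using assms by (intro exists_nonlinear_balanced_symmetric_large) auto
  next
    case False
    then show ?thesis
      using assms by (intro exists_nonlinear_balanced_symmetric_several) auto
  qed
  then show ?thesis
    by (metis anf_eval_surj)
qed

end
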